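(* Let $q>1$, $\mathcal{Q}=\{q^n:n\in\mathbb{N}_0\}$, $a\in\mathcal{Q}$, $r\in\mathbb{N}$, and let $f_0,f_1,\ldots,f_r:[a,+\infty[\rightarrow\mathbb{R}$. If $$\lim_{T\to+\infty}\inf_{T'\ge T}\int_a^{T'}\left(\sum_{i=0}^{r}f_i(t)\,D_q^i[\eta\circ\sigma^{r-i}](t)\right)d_qt=0$$ for all $\eta:[a,+\infty[\rightarrow\mathbb{R}$ such that $\eta(a)=0$, $D_q[\eta](a)=0$, ..., $D_q^{r-1}[\eta](a)=0$, then, for all such $\eta$ and for $k=1,2,\ldots,r$, $$\lim_{T\to+\infty}\inf_{T'\ge T}\left\{\left(f_{r-(k-1)}(T')+\sum_{i=1}^{k-1}(-1)^iD_q^i[f_{r-(k-1)+i}](T')\cdot\prod_{j=1}^{i}\left(\frac1q\right)^{r-(k-1)+(j-1)}\right)\cdot D_q^{r-k}[\eta\circ\sigma^{k-1}](T')\right\}=0.$$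
   Context: Here $q>1$ is a fixed real, $\mathcal{Q}=\{q^n:n\in\mathbb{N}_0\}$, $\mathbb{N}=\{1,2,\ldots\}$, and intervals are $q$-intervals: $[a,+\infty[=\{t\in\mathcal{Q}:t\ge a\}$. The map $\sigma$ is $\sigma(t)=qt$, with $\sigma^0=\mathrm{id}$ and $\sigma^k(t)=q^kt$. The Jackson $q$-difference operator is $D_q[f](t)=\frac{f(qt)-f(t)}{(q-1)t}$, with $D_q^0[f]=f$ and $D_q^i[f]=D_q[D_q^{i-1}[f]]$. For $b=aq^n$ ($n\in\mathbb{N}_0$), $\int_a^bf(t)\,d_qt=a(q-1)\sum_{k=0}^{n-1}q^kf(aq^k)$. In $\lim_{T\to+\infty}\inf_{T'\ge T}$, $T$ and $T'$ range over elements of $\mathcal{Q}$ with $T'\ge T>a$, and infima and limits are taken in $\overline{\mathbb{R}}=\mathbb{R}\cup\{\pm\infty\}$. Empty sums are $0$. *)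

theory Defs
  imports Complex_Main "HOL-Library.Extended_Real"
begin

text \<open>
  Functions on a $q$-interval $[a,+\infty[$ are represented by total functions on the reals.
  All operations below, evaluated at points of the $q$-interval, only use values
  at points of that interval, so the values elsewhere are irrelevant.
\<close>

definition qset :: "real \<Rightarrow> real set" where
  "qset q = {q ^ n | n. True}"

definition qsigma :: "real \<Rightarrow> real \<Rightarrow> real" where
  "qsigma q t = q * t"

definition Dq :: "real \<Rightarrow> (real \<Rightarrow> real) \<Rightarrow> real \<Rightarrow> real" where
  "Dq q f t = (f (q * t) - f t) / ((q - 1) * t)"

text \<open>The integral from \<open>a\<close> to \<open>b\<close>, meaningful for \<open>b = a * q ^ n\<close>; see \<open>qintegral_power\<close>.\<close>

definition qintegral :: "real \<Rightarrow> real \<Rightarrow> real \<Rightarrow> (real \<Rightarrow> real) \<Rightarrow> real" where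
  "qintegral q a b f =
     a * (q - 1) * (\<Sum>k<(THE n. b = a * q ^ n). q ^ k * f (a * q ^ k))"

lemma qintegral_power:
  assumes "q > 1" and "a > 0"
  shows "qintegral q a (a * q ^ n) f = a * (q - 1) * (\<Sum>k<n. q ^ k * f (a * q ^ k))"
proof -
  have "(THE m. a * q ^ n = a * q ^ m) = n"
    using assms by (intro the_equality) (auto simp: power_inject_exp)
  then show ?thesis
    by (simp add: qintegral_def)
qed

text \<open>
  \<open>has_lim_inf q a F L\<close> states that
  $\lim_{T\to+\infty}\inf_{T'\ge T} F(T')$ exists and equals \<open>L\<close>,
  where \<open>T\<close> and \<open>T'\<close> range over \<open>qset q\<close> with $T' \ge T > a$,
  and the infimum and the limit are taken in the extended reals.
\<close>

definition has_lim_inf :: "real \<Rightarrow> real \<Rightarrow> (real \<Rightarrow> real) \<Rightarrow> ereal \<Rightarrow> bool" where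
  "has_lim_inf q a F L \<longleftrightarrow>
     ((\<lambda>T. INF T'\<in>{T' \<in> qset q. T \<le> T'}. ereal (F T')) \<longlongrightarrow> L)
       (inf at_top (principal {T \<in> qset q. a < T}))"

end

theory Submission
  imports Defs
begin

text \<open>
  Much more than a vanishing lower limit is true: for each \<open>k\<close>, the coefficient of
  $D_q^{r-k}[\eta\circ\sigma^{k-1}](T')$ is itself zero for all large \<open>T'\<close>.

  Write \<open>x n = a * q ^ n\<close>. Repeated summation by parts, which at each step absorbs the
  highest remaining difference of \<open>\<eta>\<close> into the next lower one, turns the integral up to
  \<open>x n\<close> into
  \[ \sum_{k<r} b_k(x_n)\, D_q^{r-1-k}[\eta\circ\sigma^k](x_n)
     + \int_a^{x_n} b_r(t)\,\eta(q^r t)\,d_qt, \]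
  where \<open>b k\<close> obeys a two-term recursion (\<open>boundary_coeff\<close>), and solving it shows that
  \<open>b (k - 1)\<close> is the \<open>k\<close>-th coefficient of the statement (\<open>boundary_coeff_eq_sum\<close>). The terms at \<open>a\<close>
  drop out because the initial conditions on \<open>\<eta>\<close> say that \<open>\<eta>\<close> vanishes at \<open>x 0, \<dots>, x (r - 1)\<close>;
  its later values are free. A lower limit equal to \<open>0\<close> only bounds the integral from below by
  any fixed negative number for large \<open>n\<close>, but as \<open>\<eta>\<close> ranges over all these sequences this is
  enough: it suffices to produce an \<open>\<eta>\<close> for which the integral equals \<open>-1\<close> infinitely often.

  If \<open>b r\<close> were nonzero at some \<open>x j\<close>, an \<open>\<eta>\<close> supported at \<open>x (j + r)\<close> alone would make the
  integral equal to \<open>-1\<close> for all \<open>n > j + r\<close>. Hence only the boundary sum is left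
  (\<open>remainder_coeff_eq_0\<close>). That sum involves \<open>\<eta>\<close> only on the window \<open>x n, \<dots>, x (n + r - 1)\<close>,
  and it is triangular: its \<open>k\<close>-th term uses only the values from \<open>x (n + k)\<close> on. For \<open>n\<close> in a
  single residue class modulo \<open>r\<close> the windows are disjoint, so that \<open>\<eta>\<close> can be prescribed on
  each of them separately, and induction on \<open>k\<close> shows that every \<open>b k (x n)\<close> is zero for
  large \<open>n\<close> (\<open>boundary_coeffs_eventually_0\<close>).
\<close>

section \<open>The Jackson difference operator along a geometric progression\<close>

lemma qsigma_funpow: "(qsigma q ^^ p) t = q ^ p * t"
  by (induction p) (auto simp: qsigma_def algebra_simps)

lemma Dq_funpow_Suc: "(Dq q ^^ Suc m) g t = ((Dq q ^^ m) g (q * t) - (Dq q ^^ m) g t) / ((q - 1) * t)"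
  by (simp add: Dq_def)

lemma Dq_funpow_eq_0:
  assumes "\<And>i. i \<le> m \<Longrightarrow> g (q ^ i * t) = 0"
  shows "(Dq q ^^ m) g t = 0"
  using assms
proof (induction m arbitrary: t)
  case 0
  from "0.prems"[of 0] show ?case by simp
next
  case (Suc m)
  have "(Dq q ^^ m) g t = 0"
    by (rule Suc.IH) (use Suc.prems in auto)
  moreover have "(Dq q ^^ m) g (q * t) = 0"
  proof (rule Suc.IH)
    fix i assume "i \<le> m"
    then show "g (q ^ i * (q * t)) = 0"
      using Suc.prems[of "Suc i"] by (simp add: mult_ac)
  qed
  ultimately show ?case
    by (simp only: Dq_funpow_Suc) simp
qed

text \<open>
  The value \<open>g t\<close> enters the \<open>m\<close>-th difference at \<open>t\<close> with a nonzero factor if \<open>q \<noteq> 1\<close> and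
  \<open>t \<noteq> 0\<close>. It can therefore be chosen to give this difference any value.
\<close>
lemma Dq_funpow_first_point:
  assumes "\<And>i. 0 < i \<Longrightarrow> i \<le> m \<Longrightarrow> g (q ^ i * t) = 0"
  shows "(Dq q ^^ m) g t = g t * (- 1 / ((q - 1) * t)) ^ m"
  using assms
proof (induction m)
  case 0
  then show ?case by simp
next
  case (Suc m)
  have "(Dq q ^^ m) g (q * t) = 0"
  proof (rule Dq_funpow_eq_0)
    fix i assume "i \<le> m"
    then show "g (q ^ i * (q * t)) = 0"
      using Suc.prems[of "Suc i"] by (simp add: mult_ac)
  qed
  moreover have "(Dq q ^^ m) g t = g t * (- 1 / ((q - 1) * t)) ^ m"
    by (rule Suc.IH) (use Suc.prems in auto)
  ultimately show ?case
    by (simp only: Dq_funpow_Suc) simp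
qed

text \<open>
  Summation by parts produces a factor evaluated at \<open>q * t\<close>. By the chain rule for the dilation
  \<open>t \<mapsto> q * t\<close>, evaluating there is composing with one more \<open>qsigma\<close> up to a power of \<open>q\<close>;
  this is where the powers of \<open>1 / q\<close> in the boundary coefficients come from.
\<close>
lemma Dq_funpow_comp_qsigma_shift:
  fixes q :: real
  assumes "q \<noteq> 0"
  shows "(Dq q ^^ m) (\<eta> \<circ> (qsigma q ^^ p)) (q * t)
    = (1 / q) ^ m * (Dq q ^^ m) (\<eta> \<circ> (qsigma q ^^ Suc p)) t"
proof (induction m arbitrary: t)
  case 0
  show ?case by (simp add: qsigma_funpow mult_ac del: funpow.simps)
next
  case (Suc m)
  show ?case
    unfolding Dq_funpow_Suc Suc.IH using assms
    by (simp add: divide_simps)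
qed

lemma Dq_sum: "Dq q (\<lambda>t. \<Sum>i\<in>A. g i t) = (\<lambda>t. \<Sum>i\<in>A. Dq q (g i) t)"
  by (simp add: Dq_def fun_eq_iff sum_divide_distrib flip: sum_subtractf)

lemma Dq_cmult: "Dq q (\<lambda>t. c * g t) = (\<lambda>t. c * Dq q g t)"
  by (simp add: Dq_def fun_eq_iff right_diff_distrib)

section \<open>Iterated summation by parts\<close>

text \<open>
  After \<open>k\<close> summations by parts this is the coefficient of the highest difference that is left,
  the one of order \<open>r - k\<close>. The next summation differentiates it and subtracts a multiple of
  the result from the coefficient \<open>f (r - Suc k)\<close> already present in the next lower order.
\<close>
fun boundary_coeff :: "real \<Rightarrow> nat \<Rightarrow> (nat \<Rightarrow> real \<Rightarrow> real) \<Rightarrow> nat \<Rightarrow> real \<Rightarrow> real" where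
  "boundary_coeff q r f 0 = f r"
| "boundary_coeff q r f (Suc k)
    = (\<lambda>t. f (r - Suc k) t - (1 / q) ^ (r - Suc k) * Dq q (boundary_coeff q r f k) t)"

text \<open>
  Unrolling the recursion: a step applies \<open>Dq\<close> to the sum and multiplies it by
  \<open>- (1 / q) ^ (r - Suc k)\<close>, which becomes the first factor of each product; \<open>f (r - Suc k)\<close>
  is the new term of index \<open>0\<close>.
\<close>
lemma boundary_coeff_eq_sum:
  assumes "k \<le> r"
  shows "boundary_coeff q r f k = (\<lambda>t. \<Sum>i=0..k. ((- 1) ^ i * (\<Prod>j=1..i. (1 / q) ^ (r - k + (j - 1))))
              * (Dq q ^^ i) (f (r - k + i)) t)"
  using assms
proof (induction k)
  case 0
  then show ?case by simp
next
  case (Suc k)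
  define m where "m = r - Suc k"
  have m: "r - k = Suc m" using Suc.prems by (simp add: m_def)
  have prod: "(\<Prod>j=1..Suc i. (1 / q) ^ (m + (j - 1))) = (1 / q) ^ m * (\<Prod>j=1..i. (1 / q) ^ (Suc m + (j - 1)))" for i
  proof -
    have "(\<Prod>j=1..Suc i. (1 / q) ^ (m + (j - 1)))
      = (1 / q) ^ m * (\<Prod>j=Suc 1..Suc i. (1 / q) ^ (m + (j - 1)))"
      by (subst prod.atLeast_Suc_atMost) auto
    also have "(\<Prod>j=Suc 1..Suc i. (1 / q) ^ (m + (j - 1))) = (\<Prod>j=1..i. (1 / q) ^ (Suc m + (j - 1)))"
      by (subst prod.shift_bounds_cl_Suc_ivl) (intro prod.cong refl, auto)
    finally show ?thesis .
  qed
  show ?case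
  proof
    fix t
    have "boundary_coeff q r f (Suc k) t = f m t - (1 / q) ^ m *
      (\<Sum>i=0..k. ((- 1) ^ i * (\<Prod>j=1..i. (1 / q) ^ (Suc m + (j - 1)))) * (Dq q ^^ Suc i) (f (Suc m + i)) t)"
      using Suc by (simp add: m m_def[symmetric] Dq_sum Dq_cmult)
    also have "\<dots> = f m t + (\<Sum>i=0..k. ((- 1) ^ Suc i * (\<Prod>j=1..Suc i. (1 / q) ^ (m + (j - 1))))
              * (Dq q ^^ Suc i) (f (m + Suc i)) t)"
      unfolding prod by (simp add: sum_distrib_left sum_negf mult_ac)
    also have "\<dots> = (\<Sum>i=0..Suc k. ((- 1) ^ i * (\<Prod>j=1..i. (1 / q) ^ (m + (j - 1))))
              * (Dq q ^^ i) (f (m + i)) t)"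
      by (simp only: sum.atLeast0_atMost_Suc_shift) simp
    finally show "boundary_coeff q r f (Suc k) t = (\<Sum>i=0..Suc k. ((- 1) ^ i * (\<Prod>j=1..i. (1 / q) ^ (r - Suc k + (j - 1))))
              * (Dq q ^^ i) (f (r - Suc k + i)) t)"
      unfolding m_def .
  qed
qed

lemma qintegral_add:
  assumes "q > 1" "a > 0"
  shows "qintegral q a (a * q ^ n) (\<lambda>t. g t + h t)
    = qintegral q a (a * q ^ n) g + qintegral q a (a * q ^ n) h"
  using assms by (simp add: qintegral_power sum.distrib ring_distribs)

text \<open>
  The product rule \<open>Dq q (\<lambda>t. F t * g t) t = F t * Dq q g t + Dq q F t * g (q * t)\<close>, summed by
  telescoping.
\<close>
lemma qintegral_by_parts:
  assumes "q > 1" "a > 0"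
  shows "qintegral q a (a * q ^ n) (\<lambda>t. F t * Dq q g t)
    = F (a * q ^ n) * g (a * q ^ n) - F a * g a
      + qintegral q a (a * q ^ n) (\<lambda>t. - Dq q F t * g (q * t))"
proof (induction n)
  case 0
  then show ?case using assms by (simp add: qintegral_power[of q a 0, simplified])
next
  case (Suc n)
  have step: "qintegral q a (a * q ^ Suc n) h
    = qintegral q a (a * q ^ n) h + (q - 1) * (a * q ^ n) * h (a * q ^ n)" for h
    unfolding qintegral_power[OF assms] by (simp add: algebra_simps)
  have nz: "(q - 1) * (a * q ^ n) \<noteq> 0" using assms by simp
  have D: "(q - 1) * (a * q ^ n) * Dq q h (a * q ^ n) = h (a * q ^ Suc n) - h (a * q ^ n)" for h
    unfolding Dq_def using nz by (simp add: mult_ac)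
  have "(q - 1) * (a * q ^ n) * (F (a * q ^ n) * Dq q g (a * q ^ n))
    = F (a * q ^ n) * (g (a * q ^ Suc n) - g (a * q ^ n))"
    unfolding D[symmetric] by simp
  moreover have "(q - 1) * (a * q ^ n) * (- Dq q F (a * q ^ n) * g (q * (a * q ^ n)))
    = - (F (a * q ^ Suc n) - F (a * q ^ n)) * g (a * q ^ Suc n)"
    unfolding D[symmetric] by (simp add: mult_ac)
  ultimately show ?case
    unfolding step Suc.IH by (simp add: algebra_simps)
qed

text \<open>
  The state after \<open>K\<close> summations by parts: \<open>K\<close> boundary terms have been split off and only
  differences of order at most \<open>r - K\<close> remain under the integral. The case \<open>K = r\<close> is the one
  of interest; general \<open>K\<close> serves the induction.
\<close>
lemma qintegral_iterated_by_parts: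
  fixes q a :: real
  assumes "q > 1" "a > 0" and adm: "\<And>j. j < r \<Longrightarrow> \<eta> (a * q ^ j) = 0" and "K \<le> r"
  shows "qintegral q a (a * q ^ n) (\<lambda>t. \<Sum>i=0..r. f i t * (Dq q ^^ i) (\<eta> \<circ> (qsigma q ^^ (r - i))) t)
    = (\<Sum>k<K. boundary_coeff q r f k (a * q ^ n) * (Dq q ^^ (r - Suc k)) (\<eta> \<circ> (qsigma q ^^ k)) (a * q ^ n))
    + qintegral q a (a * q ^ n) (\<lambda>t. boundary_coeff q r f K t * (Dq q ^^ (r - K)) (\<eta> \<circ> (qsigma q ^^ K)) t
        + (\<Sum>i<r - K. f i t * (Dq q ^^ i) (\<eta> \<circ> (qsigma q ^^ (r - i))) t))"
  using \<open>K \<le> r\<close>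
proof (induction K)
  case 0
  have "{0..r} = insert r {..<r}" by auto
  then show ?case by simp
next
  case (Suc K)
  define m where "m = r - Suc K"
  have m: "r - K = Suc m" and m': "r - m = Suc K"
    using Suc.prems by (auto simp: m_def)
  let ?I = "qintegral q a (a * q ^ n)"
  let ?b = "boundary_coeff q r f"
  let ?D = "\<lambda>i p. (Dq q ^^ i) (\<eta> \<circ> (qsigma q ^^ p))"
  let ?R = "\<lambda>t. \<Sum>i<m. f i t * ?D i (r - i) t"
  have at_a: "?D m K a = 0"
  proof (rule Dq_funpow_eq_0)
    fix i assume "i \<le> m"
    then have "K + i < r" using Suc.prems by (simp add: m_def)
    from adm[OF this] show "(\<eta> \<circ> (qsigma q ^^ K)) (q ^ i * a) = 0"
      by (simp add: qsigma_funpow power_add mult_ac)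
  qed
  have shift: "?D m K (q * t) = (1 / q) ^ m * ?D m (Suc K) t" for t
    using Dq_funpow_comp_qsigma_shift[of q m \<eta> K t] assms(1) by simp
  have "?I (\<lambda>t. ?b K t * ?D (Suc m) K t) = ?b K (a * q ^ n) * ?D m K (a * q ^ n)
      + ?I (\<lambda>t. - Dq q (?b K) t * ?D m K (q * t))"
    using qintegral_by_parts[OF assms(1,2), of n "?b K" "?D m K"] at_a by simp
  moreover have "?I (\<lambda>t. ?b K t * ?D (r - K) K t + (\<Sum>i<r - K. f i t * ?D i (r - i) t))
     = ?I (\<lambda>t. ?b K t * ?D (Suc m) K t) + ?I (\<lambda>t. \<Sum>i<Suc m. f i t * ?D i (r - i) t)"
    unfolding m by (rule qintegral_add[OF assms(1,2)])
  moreover have "?I (\<lambda>t. - Dq q (?b K) t * ?D m K (q * t)) + ?I (\<lambda>t. \<Sum>i<Suc m. f i t * ?D i (r - i) t)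
     = ?I (\<lambda>t. ?b (Suc K) t * ?D m (Suc K) t + ?R t)"
    unfolding qintegral_add[OF assms(1,2), symmetric]
    by (intro arg_cong[where f = ?I] ext)
       (simp only: shift, simp add: m' m_def[symmetric] algebra_simps del: funpow.simps)
  ultimately have step: "?I (\<lambda>t. ?b K t * ?D (r - K) K t + (\<Sum>i<r - K. f i t * ?D i (r - i) t))
     = ?b K (a * q ^ n) * ?D m K (a * q ^ n) + ?I (\<lambda>t. ?b (Suc K) t * ?D m (Suc K) t + ?R t)"
    by linarith
  show ?case
    unfolding Suc.IH[OF Suc_leD[OF Suc.prems]] step m_def[symmetric] sum.lessThan_Suc add.assoc
    by (rule refl)
qed

section \<open>Lower limits along the q-interval\<close>

text \<open>
  A one-sided bound is all that a lower limit gives. It suffices because the test functions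
  below can be chosen to drive the integral to a negative value.
\<close>
lemma has_lim_inf_imp_eventually_greater:
  fixes q a :: real
  assumes "q > 1" and "a \<in> qset q" and "has_lim_inf q a F 0" and "e > 0"
  shows "\<forall>\<^sub>F n in sequentially. F (a * q ^ n) > - e"
proof -
  from assms(2) obtain m where m: "a = q ^ m" by (auto simp: qset_def)
  have qs: "a * q ^ n \<in> qset q" for n by (auto simp: qset_def m power_add[symmetric])
  have pos: "a > 0" using assms(1) m by simp
  have "\<forall>\<^sub>F T in inf at_top (principal {T \<in> qset q. a < T}).
      ereal (- e) < (INF T'\<in>{T' \<in> qset q. T \<le> T'}. ereal (F T'))"
    using assms(3,4) unfolding has_lim_inf_def by (intro order_tendstoD(1)) auto
  then obtain N where N: "\<And>T. T \<ge> N \<Longrightarrow> T \<in> qset q \<Longrightarrow> a < T \<Longrightarrow>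
      ereal (- e) < (INF T'\<in>{T' \<in> qset q. T \<le> T'}. ereal (F T'))"
    unfolding eventually_inf_principal eventually_at_top_linorder by auto
  obtain n0 where n0: "max (N / a) 1 < q ^ n0"
    using real_arch_pow[OF assms(1)] by blast
  have "ereal (- e) < (INF T'\<in>{T' \<in> qset q. a * q ^ n0 \<le> T'}. ereal (F T'))"
    using n0 pos qs by (intro N) (auto simp: field_simps)
  moreover have "(INF T'\<in>{T' \<in> qset q. a * q ^ n0 \<le> T'}. ereal (F T')) \<le> ereal (F (a * q ^ n))"
    if "n \<ge> n0" for n
    using that qs pos assms(1) by (intro INF_lower) (auto intro: power_increasing)
  ultimately have "F (a * q ^ n) > - e" if "n \<ge> n0" for n
    using that less_le_trans ereal_less_eq(3) by (metis less_ereal.simps(1))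
  then show ?thesis
    unfolding eventually_sequentially by blast
qed

lemma has_lim_inf_0_if_eventually_0:
  fixes q a :: real
  assumes "q > 1" and "a \<in> qset q" and "\<forall>\<^sub>F n in sequentially. F (a * q ^ n) = 0"
  shows "has_lim_inf q a F 0"
proof -
  from assms(2) obtain m where m: "a = q ^ m" by (auto simp: qset_def)
  from assms(3) obtain N where N: "\<And>n. n \<ge> N \<Longrightarrow> F (a * q ^ n) = 0"
    unfolding eventually_sequentially by blast
  have zero: "F T = 0" if T: "T \<in> qset q" "a * q ^ N \<le> T" for T
  proof -
    from T(1) obtain j where j: "T = q ^ j" by (auto simp: qset_def)
    with T(2) have "q ^ (m + N) \<le> q ^ j" by (simp add: m power_add)
    then have le: "m + N \<le> j" using assms(1) by (simp add: power_increasing_iff)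
    then have "T = a * q ^ (j - m)" by (simp add: j m power_add[symmetric])
    then show ?thesis using N[of "j - m"] le by simp
  qed
  have "(INF T'\<in>{T' \<in> qset q. T \<le> T'}. ereal (F T')) = 0"
    if "T \<in> qset q" "a * q ^ N \<le> T" for T
  proof -
    have "(INF T'\<in>{T' \<in> qset q. T \<le> T'}. ereal (F T')) = (INF T'\<in>{T' \<in> qset q. T \<le> T'}. 0)"
      using that zero by (intro INF_cong) (auto simp: zero_ereal_def)
    also have "\<dots> = 0" using that by (intro cINF_const) auto
    finally show ?thesis .
  qed
  then show ?thesis
    unfolding has_lim_inf_def
    by (intro tendsto_eventually)
       (auto simp: eventually_inf_principal eventually_at_top_linorder intro!: exI[of _ "a * q ^ N"])
qed

section \<open>Test functions that isolate one coefficient\<close>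

text \<open>
  For \<open>q > 1\<close> and \<open>a > 0\<close> the points \<open>a * q ^ n\<close> are distinct, so values prescribed by the index
  define a function there; elsewhere its value is unspecified.
\<close>
definition extend_seq :: "real \<Rightarrow> real \<Rightarrow> (nat \<Rightarrow> real) \<Rightarrow> real \<Rightarrow> real" where
  "extend_seq q a s t = s (THE n. t = a * q ^ n)"

lemma extend_seq_power:
  assumes "q > 1" "a > 0"
  shows "extend_seq q a s (a * q ^ n) = s n"
proof -
  have "(THE m. a * q ^ n = a * q ^ m) = n"
    using assms by (intro the_equality) (auto simp: power_inject_exp)
  then show ?thesis by (simp add: extend_seq_def)
qed

lemma extend_seq_shift:
  assumes "q > 1" "a > 0"
  shows "(extend_seq q a s \<circ> (qsigma q ^^ p)) (q ^ i * (a * q ^ n)) = s (n + p + i)"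
proof -
  have "(extend_seq q a s \<circ> (qsigma q ^^ p)) (q ^ i * (a * q ^ n)) = extend_seq q a s (a * q ^ (n + p + i))"
    by (simp add: qsigma_funpow power_add mult_ac)
  then show ?thesis by (simp only: extend_seq_power[OF assms])
qed

lemma Dq_extend_seq_eq_0:
  assumes "q > 1" "a > 0" and "\<And>i. i \<le> m \<Longrightarrow> s (n + p + i) = 0"
  shows "(Dq q ^^ m) (extend_seq q a s \<circ> (qsigma q ^^ p)) (a * q ^ n) = 0"
  by (rule Dq_funpow_eq_0) (simp add: extend_seq_shift assms del: comp_apply)

lemma Dq_extend_seq_admissible:
  assumes "q > 1" "a > 0" and "\<And>j. j < r \<Longrightarrow> s j = 0"
  shows "\<forall>i<r. (Dq q ^^ i) (extend_seq q a s) a = 0"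
  using Dq_extend_seq_eq_0[OF assms(1,2), of _ s 0 0] assms(3) by simp

text \<open>
  With \<open>\<eta>\<close> supported at the single point \<open>a * q ^ (j + r)\<close>, the integral picks out the value
  \<open>c (a * q ^ j)\<close>, and the boundary terms vanish as soon as \<open>n > j + r\<close>. So a nonzero value
  would let the whole expression be \<open>-1\<close> for all such \<open>n\<close>.
\<close>
lemma remainder_coeff_eq_0:
  fixes q a :: real
  assumes "q > 1" "a > 0"
    and lower: "\<And>s. (\<And>j. j < r \<Longrightarrow> s j = 0) \<Longrightarrow> \<forall>\<^sub>F n in sequentially.
      (\<Sum>k<r. b k (a * q ^ n) * (Dq q ^^ (r - Suc k)) (extend_seq q a s \<circ> (qsigma q ^^ k)) (a * q ^ n))
      + qintegral q a (a * q ^ n) (\<lambda>t. c t * (extend_seq q a s \<circ> (qsigma q ^^ r)) t) > - 1"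
  shows "c (a * q ^ j) = 0"
proof (rule ccontr)
  assume nz: "c (a * q ^ j) \<noteq> 0"
  define w where "w = a * (q - 1) * q ^ j * c (a * q ^ j)"
  have w: "w \<noteq> 0" using nz assms by (simp add: w_def)
  define s where "s n = (if n = j + r then - 1 / w else 0)" for n
  have "\<exists>n. n > j + r \<and>
      (\<Sum>k<r. b k (a * q ^ n) * (Dq q ^^ (r - Suc k)) (extend_seq q a s \<circ> (qsigma q ^^ k)) (a * q ^ n))
      + qintegral q a (a * q ^ n) (\<lambda>t. c t * (extend_seq q a s \<circ> (qsigma q ^^ r)) t) > - 1"
    by (rule eventually_happens'[OF _ eventually_conj[OF eventually_gt_at_top lower]])
       (auto simp: s_def)
  then obtain n where n: "n > j + r" and gt:
      "(\<Sum>k<r. b k (a * q ^ n) * (Dq q ^^ (r - Suc k)) (extend_seq q a s \<circ> (qsigma q ^^ k)) (a * q ^ n))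
      + qintegral q a (a * q ^ n) (\<lambda>t. c t * (extend_seq q a s \<circ> (qsigma q ^^ r)) t) > - 1"
    by blast
  have "(\<Sum>k<r. b k (a * q ^ n) * (Dq q ^^ (r - Suc k)) (extend_seq q a s \<circ> (qsigma q ^^ k)) (a * q ^ n)) = 0"
    using n by (intro sum.neutral ballI)
      (simp add: Dq_extend_seq_eq_0[OF assms(1,2)] s_def del: comp_apply)
  moreover have "qintegral q a (a * q ^ n) (\<lambda>t. c t * (extend_seq q a s \<circ> (qsigma q ^^ r)) t) = - 1"
  proof -
    have "(extend_seq q a s \<circ> (qsigma q ^^ r)) (a * q ^ i) = s (i + r)" for i
      using extend_seq_shift[OF assms(1,2), of s r 0 i] by simp
    then have "qintegral q a (a * q ^ n) (\<lambda>t. c t * (extend_seq q a s \<circ> (qsigma q ^^ r)) t)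
      = a * (q - 1) * (\<Sum>i<n. q ^ i * (c (a * q ^ i) * s (i + r)))"
      using assms by (simp add: qintegral_power del: comp_apply)
    also have "(\<Sum>i<n. q ^ i * (c (a * q ^ i) * s (i + r)))
      = (\<Sum>i<n. if i = j then q ^ j * (c (a * q ^ j) * (- 1 / w)) else 0)"
      by (intro sum.cong refl) (auto simp: s_def)
    also have "\<dots> = q ^ j * (c (a * q ^ j) * (- 1 / w))"
      using n by simp
    finally show ?thesis using w by (simp add: w_def)
  qed
  ultimately show False using gt by simp
qed

text \<open>
  The \<open>k\<close>-th boundary term at \<open>a * q ^ n\<close> sees the values of \<open>\<eta>\<close> at the indices \<open>n + k\<close> to
  \<open>n + r - 1\<close>. Once the earlier coefficients are known to vanish, an \<open>\<eta>\<close> that is nonzero only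
  at the index \<open>n + k\<close> of the window makes the whole sum a nonzero multiple of \<open>b k (a * q ^ n)\<close>.
  Overlapping windows would interfere, so \<open>n\<close> is restricted to one residue class modulo \<open>r\<close>
  at a time; finitely many classes cover all \<open>n\<close>.
\<close>
lemma boundary_coeffs_eventually_0:
  fixes q a :: real
  assumes "q > 1" "a > 0"
    and lower: "\<And>s. (\<And>j. j < r \<Longrightarrow> s j = 0) \<Longrightarrow> \<forall>\<^sub>F n in sequentially.
      (\<Sum>k<r. b k (a * q ^ n) * (Dq q ^^ (r - Suc k)) (extend_seq q a s \<circ> (qsigma q ^^ k)) (a * q ^ n)) > - 1"
    and "k < r"
  shows "\<forall>\<^sub>F n in sequentially. b k (a * q ^ n) = 0"
  using \<open>k < r\<close>
proof (induction k rule: less_induct)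
  case (less k)
  let ?D = "\<lambda>s k n. (Dq q ^^ (r - Suc k)) (extend_seq q a s \<circ> (qsigma q ^^ k)) (a * q ^ n)"
  have "\<forall>\<^sub>F n in sequentially. \<forall>i\<in>{..<k}. b i (a * q ^ n) = 0"
    using less by (intro eventually_ball_finite) auto
  then have earlier: "\<forall>\<^sub>F n in sequentially. \<forall>i<k. b i (a * q ^ n) = 0"
    by (simp add: Ball_def)
  have residue: "\<forall>\<^sub>F n in sequentially. n mod r = \<rho> \<longrightarrow> b k (a * q ^ n) = 0" for \<rho>
  proof -
    \<comment> \<open>\<open>w n\<close> is the factor of \<open>\<eta> (a * q ^ (n + k))\<close> in the sum. Where it is zero, division
      by zero makes \<open>s\<close> zero, too. The bound \<open>r + k \<le> j\<close> gives \<open>s\<close> its zero initial values and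
      keeps the truncated \<open>j - k\<close> exact.\<close>
    define w where "w n = b k (a * q ^ n) * (- 1 / ((q - 1) * (a * q ^ n))) ^ (r - Suc k)" for n
    define s where "s j = (if r + k \<le> j \<and> (j - k) mod r = \<rho> then - 1 / w (j - k) else 0)" for j
    have "\<forall>\<^sub>F n in sequentially. (\<Sum>k<r. b k (a * q ^ n) * ?D s k n) > - 1"
      by (rule lower) (simp add: s_def)
    then show ?thesis
      using earlier eventually_ge_at_top[of r]
    proof eventually_elim
      case (elim n)
      show ?case
      proof (intro impI, rule ccontr)
        assume \<rho>: "n mod r = \<rho>" and nz: "b k (a * q ^ n) \<noteq> 0"
        have w: "w n \<noteq> 0" using nz assms by (simp add: w_def)
        \<comment> \<open>Two indices of the residue class are at least \<open>r\<close> apart, so the next nonzero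
          value of \<open>s\<close> after \<open>n + k\<close> lies beyond the window.\<close>
        have off: "s (n + i) = 0" if "i < r" "i > k" for i
        proof -
          have "(n + (i - k)) mod r \<noteq> n mod r"
          proof
            assume "(n + (i - k)) mod r = n mod r"
            then have "r dvd (i - k)" by (simp add: mod_eq_dvd_iff_nat)
            then show False using that by (auto dest: dvd_imp_le)
          qed
          then show ?thesis using that \<rho> by (simp add: s_def)
        qed
        have at_k: "b k (a * q ^ n) * ?D s k n = - 1"
        proof -
          have "?D s k n = (extend_seq q a s \<circ> (qsigma q ^^ k)) (a * q ^ n)
            * (- 1 / ((q - 1) * (a * q ^ n))) ^ (r - Suc k)"
            using less.prems
            by (intro Dq_funpow_first_point)
               (simp add: extend_seq_shift[OF assms(1,2)] off add.assoc del: comp_apply)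
          also have "(extend_seq q a s \<circ> (qsigma q ^^ k)) (a * q ^ n) = s (n + k)"
            using extend_seq_shift[OF assms(1,2), of s k 0 n] by simp
          also have "s (n + k) = - 1 / w n"
            using elim \<rho> by (simp add: s_def)
          finally have "?D s k n = - 1 / w n * (- 1 / ((q - 1) * (a * q ^ n))) ^ (r - Suc k)" .
          then have "b k (a * q ^ n) * ?D s k n = - 1 / w n * w n"
            by (simp only: w_def mult_ac)
          then show ?thesis using w by simp
        qed
        have "b i (a * q ^ n) * ?D s i n = 0" if "i < r" "i \<noteq> k" for i
        proof (cases "i < k")
          case True
          then show ?thesis using elim by simp
        next
          case False
          then have "?D s i n = 0"
            using that by (intro Dq_extend_seq_eq_0[OF assms(1,2)]) (simp add: off add.assoc)
          then show ?thesis by simp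
        qed
        then have "(\<Sum>i<r. b i (a * q ^ n) * ?D s i n) = (\<Sum>i<r. if i = k then - 1 else 0)"
          using at_k by (intro sum.cong) auto
        then show False using elim less.prems by simp
      qed
    qed
  qed
  have "\<forall>\<^sub>F n in sequentially. \<forall>\<rho>\<in>{..<r}. n mod r = \<rho> \<longrightarrow> b k (a * q ^ n) = 0"
    using residue by (intro eventually_ball_finite) auto
  then show ?case
    by eventually_elim (use less.prems in auto)
qed

section \<open>Vanishing of the boundary terms\<close>

theorem lemma9:
  fixes q a :: real and r :: nat and f :: "nat \<Rightarrow> real \<Rightarrow> real"
  assumes "q > 1" and "a \<in> qset q" and "r \<ge> 1"
    and "\<And>\<eta> :: real \<Rightarrow> real. (\<forall>i<r. (Dq q ^^ i) \<eta> a = 0) \<Longrightarrow>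
      has_lim_inf q a
        (\<lambda>T'. qintegral q a T'
          (\<lambda>t. \<Sum>i=0..r. f i t * (Dq q ^^ i) (\<eta> \<circ> (qsigma q ^^ (r - i))) t)) 0"
  shows "\<forall>\<eta> :: real \<Rightarrow> real. (\<forall>i<r. (Dq q ^^ i) \<eta> a = 0) \<longrightarrow>
    (\<forall>k\<in>{1..r}. has_lim_inf q a
      (\<lambda>T'. (f (r - (k - 1)) T'
          + (\<Sum>i=1..k - 1. (- 1) ^ i * (Dq q ^^ i) (f (r - (k - 1) + i)) T'
              * (\<Prod>j=1..i. (1 / q) ^ (r - (k - 1) + (j - 1)))))
        * (Dq q ^^ (r - k)) (\<eta> \<circ> (qsigma q ^^ (k - 1))) T') 0)"
proof -
  have a: "a > 0" using assms(1,2) by (auto simp: qset_def)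
  let ?b = "boundary_coeff q r f"
  let ?bd = "\<lambda>s n. \<Sum>k<r. ?b k (a * q ^ n)
    * (Dq q ^^ (r - Suc k)) (extend_seq q a s \<circ> (qsigma q ^^ k)) (a * q ^ n)"
  have lower: "\<forall>\<^sub>F n in sequentially. ?bd s n
      + qintegral q a (a * q ^ n) (\<lambda>t. ?b r t * (extend_seq q a s \<circ> (qsigma q ^^ r)) t) > - 1"
    if s: "\<And>j. j < r \<Longrightarrow> s j = 0" for s
  proof -
    have "\<forall>\<^sub>F n in sequentially. qintegral q a (a * q ^ n)
        (\<lambda>t. \<Sum>i=0..r. f i t * (Dq q ^^ i) (extend_seq q a s \<circ> (qsigma q ^^ (r - i))) t) > - 1"
      using assms(4)[OF Dq_extend_seq_admissible[OF assms(1) a s]]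
      by (rule has_lim_inf_imp_eventually_greater[OF assms(1,2)]) simp_all
    then show ?thesis
      by (subst (asm) qintegral_iterated_by_parts[OF assms(1) a _ order_refl])
         (simp_all add: extend_seq_power[OF assms(1) a] s)
  qed
  have rem: "?b r (a * q ^ j) = 0" for j
    using assms(1) a lower by (rule remainder_coeff_eq_0)
  have "\<forall>\<^sub>F n in sequentially. ?bd s n > - 1" if "\<And>j. j < r \<Longrightarrow> s j = 0" for s
    using lower[OF that] by (simp add: qintegral_power[OF assms(1) a] rem)
  then have vanish: "\<forall>\<^sub>F n in sequentially. ?b k (a * q ^ n) = 0" if "k < r" for k
    using that by (rule boundary_coeffs_eventually_0[OF assms(1) a])
  show ?thesis
  proof (intro allI impI ballI)
    fix \<eta> :: "real \<Rightarrow> real" and k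
    assume k: "k \<in> {1..r}"
    have "?b (k - 1) T = f (r - (k - 1)) T
          + (\<Sum>i=1..k - 1. (- 1) ^ i * (Dq q ^^ i) (f (r - (k - 1) + i)) T
              * (\<Prod>j=1..i. (1 / q) ^ (r - (k - 1) + (j - 1))))" for T
      using k by (subst boundary_coeff_eq_sum) (auto simp: sum.atLeast_Suc_atMost mult_ac)
    then show "has_lim_inf q a
      (\<lambda>T'. (f (r - (k - 1)) T'
          + (\<Sum>i=1..k - 1. (- 1) ^ i * (Dq q ^^ i) (f (r - (k - 1) + i)) T'
              * (\<Prod>j=1..i. (1 / q) ^ (r - (k - 1) + (j - 1)))))
        * (Dq q ^^ (r - k)) (\<eta> \<circ> (qsigma q ^^ (k - 1))) T') 0"
      using eventually_mono[OF vanish[of "k - 1"]] k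
      by (intro has_lim_inf_0_if_eventually_0[OF assms(1,2)]) auto
  qed
qed

end
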